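(* Let $n\ge 3$ be an integer. Then $va_3^{\equiv}(K_{n,n,n})\leq 3\left\lfloor \frac{n+1}{4}\right\rfloor$.
   Context: All graphs are finite and simple. A $t$-coloring of a graph $G$ is a map $f:V(G)\to\{1,\dots,t\}$, with color classes $V_i=\{v: f(v)=i\}$. It is equitable if $\big||V_i|-|V_j|\big|\le 1$ for all $i,j$. A $(t,k)$-tree-coloring of $G$ is a $t$-coloring such that every connected component of each induced subgraph $G[V_i]$ is a tree of maximum degree at most $k$; an equitable $(t,k)$-tree-coloring is a $(t,k)$-tree-coloring that is equitable. The strong equitable vertex $k$-arboricity $va_k^{\equiv}(G)$ is the smallest integer $t$ such that $G$ has an equitable $(t',k)$-tree-coloring for every integer $t'\ge t$. $K_{n,n,n}$ denotes the complete tripartite graph whose three partite sets each have exactly $n$ vertices. *)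

theory Defs
  imports "Graph_Theory.Graph_Theory"
begin

text \<open>
  A finite simple graph is a symmetric digraph in the sense of locale \<^locale>\<open>graph\<close>: an edge
  is a pair of opposite arcs, the connected components are the members of \<^const>\<open>pre_digraph.sccs\<close>,
  and the degree of a vertex is its \<^const>\<open>out_degree\<close>.

  The constants \<^const>\<open>forest\<close> and \<^const>\<open>tree\<close> are unsuitable here, since they count the closed
  walk \<open>a, b, a\<close> along a single edge as a cycle. In a symmetric digraph without loops and
  parallel arcs, the cycles of the undirected graph are the directed cycles of length at least 3.
\<close>

definition undirected_tree :: "('a,'b) pre_digraph \<Rightarrow> bool" where
  "undirected_tree H \<longleftrightarrow> connected H \<and> \<not> (\<exists>p. pre_digraph.cycle H p \<and> 3 \<le> length p)"

definition max_degree :: "('a,'b) pre_digraph \<Rightarrow> nat" where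
  "max_degree H = Max (out_degree H ` verts H)"

definition color_class :: "('a,'b) pre_digraph \<Rightarrow> ('a \<Rightarrow> nat) \<Rightarrow> nat \<Rightarrow> 'a set" where
  "color_class G f i = {v \<in> verts G. f v = i}"

definition coloring :: "('a,'b) pre_digraph \<Rightarrow> nat \<Rightarrow> ('a \<Rightarrow> nat) \<Rightarrow> bool" where
  "coloring G t f \<longleftrightarrow> f ` verts G \<subseteq> {1..t}"

definition equitable :: "('a,'b) pre_digraph \<Rightarrow> nat \<Rightarrow> ('a \<Rightarrow> nat) \<Rightarrow> bool" where
  "equitable G t f \<longleftrightarrow>
     (\<forall>i\<in>{1..t}. \<forall>j\<in>{1..t}.
        \<bar>int (card (color_class G f i)) - int (card (color_class G f j))\<bar> \<le> 1)"

definition tree_coloring :: "('a,'b) pre_digraph \<Rightarrow> nat \<Rightarrow> nat \<Rightarrow> ('a \<Rightarrow> nat) \<Rightarrow> bool" where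
  "tree_coloring G t k f \<longleftrightarrow>
     coloring G t f \<and>
     (\<forall>i\<in>{1..t}. \<forall>H\<in>pre_digraph.sccs (G \<restriction> color_class G f i).
        undirected_tree H \<and> max_degree H \<le> k)"

definition equitable_tree_coloring ::
  "('a,'b) pre_digraph \<Rightarrow> nat \<Rightarrow> nat \<Rightarrow> ('a \<Rightarrow> nat) \<Rightarrow> bool" where
  "equitable_tree_coloring G t k f \<longleftrightarrow> tree_coloring G t k f \<and> equitable G t f"

text \<open>
  The minimum is attained for every finite simple graph: if \<open>t'\<close> is at least the number of
  vertices, an injective colouring is an equitable \<open>(t', k)\<close>-tree-colouring.
\<close>

definition strong_equitable_vertex_arboricity :: "nat \<Rightarrow> ('a,'b) pre_digraph \<Rightarrow> nat" where
  "strong_equitable_vertex_arboricity k G =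
     (LEAST t. \<forall>t'\<ge>t. \<exists>f. equitable_tree_coloring G t' k f)"

definition complete_tripartite_digraph ::
  "nat \<Rightarrow> nat \<Rightarrow> nat \<Rightarrow> ('a,'b) pre_digraph \<Rightarrow> bool" where
  "complete_tripartite_digraph l m n G \<longleftrightarrow>
     graph G \<and>
     (\<exists>U V W. verts G = U \<union> V \<union> W \<and>
        U \<inter> V = {} \<and> U \<inter> W = {} \<and> V \<inter> W = {} \<and>
        card U = l \<and> card V = m \<and> card W = n \<and>
        arcs_ends G = U \<times> V \<union> V \<times> U \<union> U \<times> W \<union> W \<times> U \<union> V \<times> W \<union> W \<times> V)"

end

theory Submission
  imports Defs
begin

text \<open>
  A vertex set induces a forest of maximum degree at most 3 as soon as it is independent or
  consists of one vertex together with an independent set of at most 3 vertices. Hence it suffices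
  to split the three parts of size \<open>n\<close> into \<open>t\<close> such sets whose sizes are \<open>s\<close> or \<open>s + 1\<close> for some
  \<open>s\<close>, which is a question about numbers only. Let \<open>q = (n + 1) div 4\<close>, so that
  \<open>4 q - 1 \<le> n \<le> 4 q + 2\<close>. For \<open>t = 3 q\<close> each part is split evenly into \<open>q\<close> independent sets. For
  \<open>t > 3 q\<close> the sizes are at most 4, except when \<open>n = 4 q + 2\<close> and \<open>t = 3 q + 1\<close>, where two of them
  are 5. In every case the same number of independent sets is taken from each part until a
  small or very regular remainder is left, and that remainder is split with stars across two parts.
\<close>

section \<open>Admissible colour classes\<close>

definition independent_set :: "('a,'b) pre_digraph \<Rightarrow> 'a set \<Rightarrow> bool" where
  "independent_set G S \<longleftrightarrow> (\<forall>e\<in>arcs G. tail G e \<in> S \<longrightarrow> head G e \<notin> S)"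

text \<open>One condition covers both kinds of piece. The vertex \<open>x\<close> need not lie in
  \<open>K\<close>, so independent sets, including the empty one, qualify. The bound 4 stands for a
  centre with three leaves.\<close>

definition star_class :: "('a,'b) pre_digraph \<Rightarrow> 'a set \<Rightarrow> bool" where
  "star_class G K \<longleftrightarrow>
     (\<exists>x. independent_set G (K - {x})) \<and> (card K \<le> 4 \<or> independent_set G K)"

lemma independent_set_subset: "independent_set G S \<Longrightarrow> T \<subseteq> S \<Longrightarrow> independent_set G T"
  unfolding independent_set_def by blast

text \<open>A cycle visits \<open>x\<close> only once, so at most two of its arcs touch
  \<open>x\<close>; among three consecutive arcs of a longer cycle one would miss it.\<close>

lemma no_long_cycle_if_arcs_meet_vertex:
  assumes meet: "\<And>e. e \<in> arcs H \<Longrightarrow> tail H e = x \<or> head H e = x"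
    and cyc: "pre_digraph.cycle H p"
  shows "length p < 3"
proof (rule ccontr)
  interpret pre_digraph H .
  assume "\<not> length p < 3"
  then obtain e1 e2 e3 r where p: "p = e1 # e2 # e3 # r"
    by (metis One_nat_def Suc_1 length_0_conv length_Suc_conv less_Suc_eq neq_Nil_conv
        numeral_3_eq_3 zero_less_Suc)
  obtain u where u: "awalk u p u" and d: "distinct (tl (awalk_verts u p))"
    using cyc unfolding cycle_def by blast
  have arcs: "e1 \<in> arcs H" "e2 \<in> arcs H" "e3 \<in> arcs H"
    and walk: "tail H e1 = u" "tail H e2 = head H e1" "tail H e3 = head H e2"
    and last: "cas (head H e3) r u"
    using u unfolding p awalk_def by auto
  have ne: "head H e1 \<noteq> head H e2" "head H e2 \<notin> set (awalk_verts (head H e3) r)"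
    "head H e1 \<notin> set (awalk_verts (head H e3) r)"
    using d walk by (auto simp: p)
  \<comment> \<open>Both ends of the remaining walk \<open>r\<close> are among its vertices, so
    \<open>head H e1\<close> and \<open>head H e2\<close> differ from \<open>u\<close> and from
    \<open>head H e3\<close>.\<close>
  have hd: "v \<in> set (awalk_verts v r)" and lst: "cas v r w \<Longrightarrow> w \<in> set (awalk_verts v r)"
    if "cas v r w" for v w
    using that by (induction r arbitrary: v) auto
  show False
    using meet[OF arcs(1)] meet[OF arcs(2)] meet[OF arcs(3)] ne walk hd[OF last] lst[OF last last]
    by metis
qed

text \<open>Every arc inside \<open>K\<close> touches the centre, which excludes long cycles. For
  the degree, either there are no arcs at all, or \<open>K\<close> offers a vertex at most three
  neighbours.\<close>

lemma (in graph) component_of_star_class: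
  assumes K: "star_class G K" "K \<subseteq> verts G" and H: "H \<in> pre_digraph.sccs (G \<restriction> K)"
  shows "undirected_tree H \<and> max_degree H \<le> 3"
proof -
  have fin: "finite K" using K(2) finite_verts finite_subset by blast
  have ind: "induced_subgraph H (G \<restriction> K)" and sc: "strongly_connected H"
    using H unfolding pre_digraph.sccs_def by auto
  have sub: "subgraph H (G \<restriction> K)" using ind by blast
  have wf: "wf_digraph H" using sub by (auto simp: subgraph_def)
  have vH: "verts H \<subseteq> K" and vne: "verts H \<noteq> {}"
    using sub sc by (auto simp: subgraph_def strongly_connected_def)
  have th: "tail H = tail G" "head H = head G"
    using sub by (auto simp: subgraph_def compatible_def)
  have aH: "e \<in> arcs G \<and> tail G e \<in> K \<and> head G e \<in> K" if "e \<in> arcs H" for e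
    using sub that by (auto simp: subgraph_def)
  obtain x where x: "independent_set G (K - {x})" using K(1) unfolding star_class_def by blast
  have "tail H e = x \<or> head H e = x" if "e \<in> arcs H" for e
    using aH[OF that] x unfolding independent_set_def th by blast
  then have "\<not> (\<exists>p. pre_digraph.cycle H p \<and> 3 \<le> length p)"
    using no_long_cycle_if_arcs_meet_vertex by (metis not_less)
  moreover have "connected H"
    unfolding connected_def
    using sc wf_digraph.reachable_mk_symmetricI[OF wf] by (auto simp: strongly_connected_def)
  ultimately have "undirected_tree H" unfolding undirected_tree_def by simp
  moreover have "out_degree H v \<le> 3" if "v \<in> verts H" for v
  proof (cases "independent_set G K")
    case True
    then have "out_arcs H v = {}" using aH unfolding independent_set_def by fastforce
    then show ?thesis by (simp add: out_degree_def)
  next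
    case False
    then have c: "card K \<le> 4" using K(1) unfolding star_class_def by blast
    \<comment> \<open>Without parallel arcs, outgoing arcs can be counted by their heads.\<close>
    have "inj_on (head G) (out_arcs H v)"
      using aH by (auto intro!: inj_onI no_multi_arcs simp: th arc_to_ends_def)
    moreover have "head G ` out_arcs H v \<subseteq> K - {v}"
      using aH no_loops by (auto simp: th)
    ultimately have "card (out_arcs H v) \<le> card (K - {v})"
      using fin by (meson card_inj_on_le finite_Diff)
    also have "\<dots> = card K - 1" using that vH fin by auto
    finally show ?thesis using c by (simp add: out_degree_def)
  qed
  then have "max_degree H \<le> 3"
    unfolding max_degree_def using finite_subset[OF vH fin] vne by (subst Max_le_iff) auto
  ultimately show ?thesis by simp
qed

section \<open>From numerical tilings to colourings\<close>

text \<open>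
  \<open>tiling s t a b c\<close>: three independent sets of sizes \<open>a\<close>, \<open>b\<close>, \<open>c\<close> can be split into \<open>t\<close> independent
  sets and stars, each of size \<open>s\<close> or \<open>s + 1\<close>. Empty pieces are allowed, as the number of colours
  may exceed the number of vertices.
\<close>

inductive tiling :: "nat \<Rightarrow> nat \<Rightarrow> nat \<Rightarrow> nat \<Rightarrow> nat \<Rightarrow> bool" for s :: nat where
  empty: "tiling s 0 0 0 0"
| block: "tiling s t a b c \<Longrightarrow> m = s \<or> m = Suc s \<Longrightarrow> tiling s (Suc t) (a + m) b c"
| star: "tiling s t a b c \<Longrightarrow> m \<le> 3 \<Longrightarrow> Suc m = s \<or> m = s \<Longrightarrow> tiling s (Suc t) (Suc a) (b + m) c"
| swap: "tiling s t a b c \<Longrightarrow> tiling s t b a c"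
| rotate: "tiling s t a b c \<Longrightarrow> tiling s t b c a"

text \<open>Fixing the two sizes \<open>s\<close> and \<open>Suc s\<close>, rather than bounding
  differences, lets a partition be built one class at a time.\<close>

definition star_partition :: "('a,'b) pre_digraph \<Rightarrow> nat \<Rightarrow> nat \<Rightarrow> 'a set \<Rightarrow> bool" where
  "star_partition G s t X \<longleftrightarrow>
     (\<exists>f. f ` X \<subseteq> {1..t} \<and>
       (\<forall>i\<in>{1..t}. star_class G {v \<in> X. f v = i} \<and>
          (card {v \<in> X. f v = i} = s \<or> card {v \<in> X. f v = i} = Suc s)))"

lemma star_partition_Suc:
  assumes "star_partition G s t X" "X \<inter> K = {}" "star_class G K" "card K = s \<or> card K = Suc s"
  shows "star_partition G s (Suc t) (X \<union> K)"
proof -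
  obtain f where f: "f ` X \<subseteq> {1..t}"
    "\<And>i. i \<in> {1..t} \<Longrightarrow> star_class G {v \<in> X. f v = i} \<and>
       (card {v \<in> X. f v = i} = s \<or> card {v \<in> X. f v = i} = Suc s)"
    using assms(1) unfolding star_partition_def by blast
  define g where "g v = (if v \<in> K then Suc t else f v)" for v
  have old: "{v \<in> X \<union> K. g v = i} = {v \<in> X. f v = i}" if "i \<in> {1..t}" for i
    using that assms(2) by (auto simp: g_def)
  have new: "{v \<in> X \<union> K. g v = Suc t} = K"
    using f(1) by (force simp: g_def)
  have "g ` (X \<union> K) \<subseteq> {1..Suc t}"
    using f(1) by (force simp: g_def)
  moreover have "star_class G {v \<in> X \<union> K. g v = i} \<and>
       (card {v \<in> X \<union> K. g v = i} = s \<or> card {v \<in> X \<union> K. g v = i} = Suc s)"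
    if "i \<in> {1..Suc t}" for i
  proof (cases "i = Suc t")
    case True
    then show ?thesis using new assms(3,4) by simp
  next
    case False
    then have "i \<in> {1..t}" using that by auto
    then show ?thesis using old f(2) by simp
  qed
  ultimately show ?thesis unfolding star_partition_def by blast
qed

text \<open>Induction on the tiling: each piece is realised by vertices chosen arbitrarily from the
  right parts, which then receive a new colour. Only the sizes of the parts matter, and subsets of
  independent sets stay independent.\<close>

lemma star_partition_if_tiling:
  assumes "tiling s t a b c"
    and "finite A" "finite B" "finite C" "card A = a" "card B = b" "card C = c"
    and "A \<inter> B = {}" "A \<inter> C = {}" "B \<inter> C = {}"
    and "independent_set G A" "independent_set G B" "independent_set G C"
  shows "star_partition G s t (A \<union> B \<union> C)"
  using assms
proof (induction arbitrary: A B C rule: tiling.induct)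
  case empty
  then show ?case by (simp add: star_partition_def)
next
  case (block t a b c m)
  obtain K where K: "K \<subseteq> A" "card K = m"
    using block.prems by (metis le_add2 obtain_subset_with_card_n)
  have "star_partition G s t ((A - K) \<union> B \<union> C)"
    using block.prems K finite_subset[OF K(1)]
    by (intro block.IH) (auto simp: card_Diff_subset intro: independent_set_subset)
  moreover have "star_class G K"
    using block.prems K unfolding star_class_def by (meson Diff_subset independent_set_subset order_trans)
  ultimately have "star_partition G s (Suc t) (((A - K) \<union> B \<union> C) \<union> K)"
    using block K by (intro star_partition_Suc) auto
  moreover have "((A - K) \<union> B \<union> C) \<union> K = A \<union> B \<union> C" using K by auto
  ultimately show ?case by simp
next
  case (star t a b c m)
  obtain x where x: "x \<in> A" using star.prems by (metis card.empty nat.distinct(1) ex_in_conv)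
  obtain S where S: "S \<subseteq> B" "card S = m"
    using star.prems by (metis le_add2 obtain_subset_with_card_n)
  have xS: "x \<notin> S" "finite S" using x S star.prems finite_subset by auto
  have "star_partition G s t ((A - {x}) \<union> (B - S) \<union> C)"
    using star.prems x S xS
    by (intro star.IH) (auto simp: card_Diff_subset intro: independent_set_subset)
  moreover have "star_class G (insert x S)"
    unfolding star_class_def
  proof
    have "independent_set G (insert x S - {x})"
      using star.prems(11) by (rule independent_set_subset) (use S(1) in auto)
    then show "\<exists>y. independent_set G (insert x S - {y})" ..
    show "card (insert x S) \<le> 4 \<or> independent_set G (insert x S)"
      using star.hyps S xS by simp
  qed
  ultimately have
    "star_partition G s (Suc t) (((A - {x}) \<union> (B - S) \<union> C) \<union> insert x S)"
    using star x S xS by (intro star_partition_Suc) auto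
  moreover have "((A - {x}) \<union> (B - S) \<union> C) \<union> insert x S = A \<union> B \<union> C" using x S by auto
  ultimately show ?case by simp
next
  case (swap t a b c)
  then have "star_partition G s t (B \<union> A \<union> C)" by (intro swap.IH) auto
  then show ?case by (simp add: Un_ac)
next
  case (rotate t a b c)
  then have "star_partition G s t (C \<union> A \<union> B)" by (intro rotate.IH) auto
  then show ?case by (simp add: Un_ac)
qed

lemma (in graph) equitable_tree_coloring_if_star_partition:
  assumes "star_partition G s t (verts G)"
  shows "\<exists>f. equitable_tree_coloring G t 3 f"
proof -
  obtain f where f: "f ` verts G \<subseteq> {1..t}"
    "\<And>i. i \<in> {1..t} \<Longrightarrow> star_class G (color_class G f i)"
    "\<And>i. i \<in> {1..t} \<Longrightarrow> card (color_class G f i) = s \<or> card (color_class G f i) = Suc s"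
    using assms unfolding star_partition_def color_class_def by blast
  have "tree_coloring G t 3 f"
    unfolding tree_coloring_def coloring_def
  proof (intro conjI ballI)
    fix i H
    assume "i \<in> {1..t}" "H \<in> pre_digraph.sccs (G \<restriction> color_class G f i)"
    moreover have "color_class G f i \<subseteq> verts G" by (auto simp: color_class_def)
    ultimately show "undirected_tree H" "max_degree H \<le> 3"
      using f(2) component_of_star_class by blast+
  qed (rule f(1))
  moreover have "equitable G t f"
    unfolding equitable_def
  proof (intro ballI)
    fix i j assume "i \<in> {1..t}" "j \<in> {1..t}"
    then show "\<bar>int (card (color_class G f i)) - int (card (color_class G f j))\<bar> \<le> 1"
      using f(3)[of i] f(3)[of j] by auto
  qed
  ultimately show ?thesis unfolding equitable_tree_coloring_def by blast
qed

section \<open>Basic moves on tilings\<close>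

lemma tiling_blocks:
  assumes "tiling s t a b c" "m = s \<or> m = Suc s"
  shows "tiling s (k + t) (k * m + a) b c"
proof (induction k)
  case (Suc k)
  from tiling.block[OF this assms(2)] show ?case by (simp add: algebra_simps)
qed (use assms in simp)

text \<open>Three rotations restore the order of the parts. This is the reduction to small
  remainders used in the constructions below.\<close>

lemma tiling_blocks_each:
  assumes "tiling s t a b c" "m = s \<or> m = Suc s"
  shows "tiling s (3 * k + t) (k * m + a) (k * m + b) (k * m + c)"
proof -
  have "tiling s (k + t) (k * m + a) b c" by (rule tiling_blocks[OF assms])
  then have "tiling s (k + (k + t)) (k * m + b) c (k * m + a)"
    using tiling_blocks[OF tiling.rotate assms(2)] by blast
  then have "tiling s (k + (k + (k + t))) (k * m + c) (k * m + a) (k * m + b)"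
    using tiling_blocks[OF tiling.rotate assms(2)] by blast
  moreover have "k + (k + (k + t)) = 3 * k + t" by simp
  ultimately show ?thesis using tiling.rotate by simp
qed

text \<open>Division with remainder cuts each part into \<open>q - n mod q\<close> blocks of size
  \<open>n div q\<close> and \<open>n mod q\<close> blocks one larger.\<close>

lemma tiling_parts:
  assumes "q > 0"
  shows "tiling (n div q) (3 * q) n n n"
proof -
  let ?s = "n div q" and ?r = "n mod q"
  have r: "?r \<le> q" using assms by (simp add: less_imp_le)
  have "tiling ?s (3 * (q - ?r) + (3 * ?r + 0)) ((q - ?r) * ?s + (?r * Suc ?s + 0))
      ((q - ?r) * ?s + (?r * Suc ?s + 0)) ((q - ?r) * ?s + (?r * Suc ?s + 0))"
    by (intro tiling_blocks_each tiling.empty) auto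
  moreover have "(q - ?r) * ?s + (?r * Suc ?s + 0) = n"
  proof -
    have "(q - ?r) * ?s + ?r * ?s = q * ?s" using r by (simp flip: add_mult_distrib)
    then show ?thesis using mult_div_mod_eq[of q n] unfolding mult_Suc_right by linarith
  qed
  moreover have "3 * (q - ?r) + (3 * ?r + 0) = 3 * q" using r by simp
  ultimately show ?thesis by simp
qed

lemma tiling_add_block:
  assumes "tiling s t a b c" "m = s \<or> m = s + 1"
  shows "tiling s (t + 1) (a + m) b c"
    and "tiling s (t + 1) a (b + m) c"
    and "tiling s (t + 1) a b (c + m)"
proof -
  have m: "m = s \<or> m = Suc s" using assms(2) by simp
  note [intro] = tiling.swap tiling.rotate
  show "tiling s (t + 1) (a + m) b c" using tiling.block[OF assms(1) m] by simp
  have "tiling s t b a c" using assms(1) by blast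
  from tiling.swap[OF tiling.block[OF this m]] show "tiling s (t + 1) a (b + m) c" by simp
  have "tiling s t c a b" using assms(1) by blast
  from tiling.rotate[OF tiling.block[OF this m]] show "tiling s (t + 1) a b (c + m)" by simp
qed

text \<open>Permuted forms of the rule \<open>star\<close>, for the choices of centre part and leaf
  part that the explicit tilings use.\<close>

lemma tiling_add_star:
  assumes "tiling s t a b c" "m \<le> 3" "m + 1 = s \<or> m = s"
  shows "tiling s (t + 1) (a + 1) (b + m) c"
    and "tiling s (t + 1) (a + 1) b (c + m)"
    and "tiling s (t + 1) a (b + 1) (c + m)"
    and "tiling s (t + 1) a (b + m) (c + 1)"
proof -
  have m: "Suc m = s \<or> m = s" using assms(3) by simp
  have bca: "tiling s t b c a" by (rule tiling.rotate[OF assms(1)])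
  have cab: "tiling s t c a b" by (rule tiling.rotate[OF bca])
  show "tiling s (t + 1) (a + 1) (b + m) c"
    using tiling.star[OF assms(1,2) m] by simp
  show "tiling s (t + 1) (a + 1) b (c + m)"
    using tiling.rotate[OF tiling.swap[OF tiling.star[OF tiling.swap[OF cab] assms(2) m]]] by simp
  show "tiling s (t + 1) a (b + 1) (c + m)"
    using tiling.rotate[OF tiling.rotate[OF tiling.star[OF bca assms(2) m]]] by simp
  show "tiling s (t + 1) a (b + m) (c + 1)"
    using tiling.rotate[OF tiling.rotate[OF tiling.swap[OF tiling.star[OF tiling.swap[OF bca] assms(2) m]]]]
    by simp
qed

section \<open>Tilings by range of piece sizes\<close>

text \<open>All pieces have size 3. For \<open>y = 1\<close> the only piece would be a triangle;
  every other \<open>y\<close> is 0, 2 or 4 plus a multiple of 3, and that multiple is filled by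
  independent triples.\<close>

lemma tiling_triples:
  assumes "y \<noteq> 1" "s = 2 \<or> s = 3"
  shows "tiling s y y y y"
proof -
  have m: "3 = s \<or> 3 = s + 1" "3 = s \<or> 3 = Suc s" and m2: "2 + 1 = s \<or> 2 = s"
    using assms(2) by auto
  have one: "tiling s 1 1 2 0"
    using tiling_add_star(1)[OF tiling.empty _ m2] by (simp add: eval_nat_numeral)
  then have two: "tiling s 2 2 2 2"
    using tiling_add_star(2)[OF one _ m2] by (simp add: eval_nat_numeral)
  \<comment> \<open>The seed for 4 consists of two stars, shaped (1,2,0) and (0,2,1), and one
    independent triple in each of the first and third parts.\<close>
  have "tiling s 2 1 4 1" using tiling_add_star(4)[OF one _ m2] by (simp add: eval_nat_numeral)
  then have "tiling s 3 4 4 1" using tiling_add_block(1)[OF _ m(1)] by fastforce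
  then have four: "tiling s 4 4 4 4" using tiling_add_block(3)[OF _ m(1)] by fastforce
  consider k where "y = 3 * k" | k where "y = 3 * k + 2" | k where "y = 3 * k + 4"
  proof -
    have "y = 3 * (y div 3) + y mod 3" "y mod 3 < 3" by simp_all
    moreover have "y = 3 * (y div 3 - 1) + 4" if "y mod 3 = 1"
      using that assms(1) by presburger
    ultimately show thesis using that by (metis One_nat_def Suc_1 add_0_right less_2_cases
        less_Suc_eq numeral_3_eq_3)
  qed
  then show ?thesis
  proof cases
    case 1
    then show ?thesis using tiling_blocks_each[OF tiling.empty m(2), of k] by (simp add: mult.commute)
  next
    case 2
    then show ?thesis using tiling_blocks_each[OF two m(2), of k] by (simp add: mult.commute)
  next
    case 3
    then show ?thesis using tiling_blocks_each[OF four m(2), of k] by (simp add: mult.commute)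
  qed
qed

text \<open>Any two vertices form a valid piece, whether from one part or from two, so only the
  total number of vertices matters. Induction on the number \<open>x\<close> of pairs removes one at
  a time.\<close>

lemma tiling_singles_pairs:
  assumes "a + b + c = 2 * x + y"
  shows "tiling 1 (x + y) a b c"
  using assms
proof (induction x arbitrary: a b c)
  case 0
  have "tiling 1 (a + 0) (a * 1 + 0) 0 0" by (intro tiling_blocks tiling.empty) simp
  then have "tiling 1 a 0 0 a" by (auto intro: tiling.rotate)
  then have "tiling 1 (b + a) (b * 1 + 0) 0 a" by (intro tiling_blocks) simp_all
  then have "tiling 1 (b + a) 0 a b" by (auto intro: tiling.rotate)
  then have "tiling 1 (c + (b + a)) (c * 1 + 0) a b" by (intro tiling_blocks) simp_all
  then have "tiling 1 (c + (b + a)) a b c" by (auto intro: tiling.rotate)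
  then show ?case using 0 by (simp add: add_ac)
next
  case (Suc x)
  consider "a \<ge> 2" | "b \<ge> 2" | "c \<ge> 2" | "a \<ge> 1" "b \<ge> 1" | "a \<ge> 1" "c \<ge> 1" | "b \<ge> 1" "c \<ge> 1"
  proof -
    have "a \<ge> 2 \<or> b \<ge> 2 \<or> c \<ge> 2 \<or> a \<ge> 1 \<and> b \<ge> 1 \<or> a \<ge> 1 \<and> c \<ge> 1 \<or> b \<ge> 1 \<and> c \<ge> 1"
      using Suc.prems by arith
    then show thesis using that by blast
  qed
  then show ?case
  proof cases
    case 1
    then have "tiling 1 (x + y) (a - 2) b c" using Suc.prems by (intro Suc.IH) simp
    from tiling_add_block(1)[OF this, of 2] show ?thesis
      by (simp add: le_add_diff_inverse2[OF 1] del: add_2_eq_Suc')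
  next
    case 2
    then have "tiling 1 (x + y) a (b - 2) c" using Suc.prems by (intro Suc.IH) simp
    from tiling_add_block(2)[OF this, of 2] show ?thesis
      by (simp add: le_add_diff_inverse2[OF 2] del: add_2_eq_Suc')
  next
    case 3
    then have "tiling 1 (x + y) a b (c - 2)" using Suc.prems by (intro Suc.IH) simp
    from tiling_add_block(3)[OF this, of 2] show ?thesis
      by (simp add: le_add_diff_inverse2[OF 3] del: add_2_eq_Suc')
  next
    case 4
    then have "tiling 1 (x + y) (a - 1) (b - 1) c" using Suc.prems by (intro Suc.IH) simp
    from tiling_add_star(1)[OF this, of 1] show ?thesis using 4 by simp
  next
    case 5
    then have "tiling 1 (x + y) (a - 1) b (c - 1)" using Suc.prems by (intro Suc.IH) simp
    from tiling_add_star(2)[OF this, of 1] show ?thesis using 5 by simp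
  next
    case 6
    then have "tiling 1 (x + y) a (b - 1) (c - 1)" using Suc.prems by (intro Suc.IH) simp
    from tiling_add_star(3)[OF this, of 1] show ?thesis using 6 by simp
  qed
qed

lemma tiling_singles_empties:
  "tiling 0 (3 * n + k) n n n"
proof -
  have "tiling 0 (k + 0) (k * 0 + 0) 0 0" by (intro tiling_blocks tiling.empty) simp
  then have "tiling 0 (3 * n + k) (n * 1 + 0) (n * 1 + 0) (n * 1 + 0)"
    by (intro tiling_blocks_each) simp_all
  then show ?thesis by simp
qed

text \<open>Counting vertices forces \<open>3 * n - 2 * t\<close> triples and
  \<open>3 * (t - n)\<close> pairs. Taking \<open>t - n\<close> pairs from each part leaves equal
  remainders for \<open>tiling_triples\<close>, unless there is exactly one triple.\<close>

lemma tiling_pairs_triples: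
  assumes "n \<ge> 3" "n \<le> t" "2 * t \<le> 3 * n"
  shows "tiling 2 t n n n"
proof (cases "3 * n - 2 * t = 1")
  case False
  have "tiling 2 (3 * (t - n) + (3 * n - 2 * t)) ((t - n) * 2 + (3 * n - 2 * t))
      ((t - n) * 2 + (3 * n - 2 * t)) ((t - n) * 2 + (3 * n - 2 * t))"
    using False by (intro tiling_blocks_each tiling_triples) auto
  moreover have "3 * (t - n) + (3 * n - 2 * t) = t" "(t - n) * 2 + (3 * n - 2 * t) = n"
    using assms by auto
  ultimately show ?thesis by simp
next
  \<comment> \<open>With a single triple, one pair per part is kept back: (3,3,3) is cut into
    (3,0,0), (0,2,0), (0,0,2), (0,1,1). The bound \<open>n \<ge> 3\<close> ensures
    \<open>t - n \<ge> 1\<close>.\<close>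
  case True
  have "tiling 2 1 3 0 0" using tiling_add_block(1)[OF tiling.empty, of 3 2] by simp
  from tiling_add_block(2)[OF this, of 2] have "tiling 2 2 3 2 0" by (simp add: eval_nat_numeral)
  from tiling_add_block(3)[OF this, of 2] have "tiling 2 3 3 2 2" by (simp add: eval_nat_numeral)
  from tiling_add_star(3)[OF this, of 1] have "tiling 2 4 3 3 3" by simp
  then have "tiling 2 (3 * (t - n - 1) + 4) ((t - n - 1) * 2 + 3)
      ((t - n - 1) * 2 + 3) ((t - n - 1) * 2 + 3)"
    by (intro tiling_blocks_each) auto
  moreover have "3 * (t - n - 1) + 4 = t" "(t - n - 1) * 2 + 3 = n"
    using assms True by linarith+
  ultimately show ?thesis by simp
qed

text \<open>Here the count forces \<open>3 * (n - t)\<close> quadruples, again split evenly over the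
  parts, and \<open>4 * t - 3 * n\<close> triples.\<close>

lemma tiling_triples_quadruples:
  assumes "n \<ge> 3" "t \<le> n" "3 * n \<le> 4 * t"
  shows "tiling 3 t n n n"
proof (cases "4 * t - 3 * n = 1")
  case False
  have "tiling 3 (3 * (n - t) + (4 * t - 3 * n)) ((n - t) * 4 + (4 * t - 3 * n))
      ((n - t) * 4 + (4 * t - 3 * n)) ((n - t) * 4 + (4 * t - 3 * n))"
    using False by (intro tiling_blocks_each tiling_triples) auto
  moreover have "3 * (n - t) + (4 * t - 3 * n) = t" "(n - t) * 4 + (4 * t - 3 * n) = n"
    using assms by auto
  ultimately show ?thesis by simp
next
  \<comment> \<open>One quadruple per part is kept back: (5,5,5) is cut into (4,0,0), (1,3,0),
    (0,2,1), (0,0,4). Here \<open>t < n\<close>, since \<open>t = n\<close> would give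
    \<open>n = 1\<close>.\<close>
  case True
  have "tiling 3 1 4 0 0" using tiling_add_block(1)[OF tiling.empty, of 4 3] by simp
  from tiling_add_star(1)[OF this, of 3] have "tiling 3 2 5 3 0" by (simp add: eval_nat_numeral)
  from tiling_add_star(4)[OF this, of 2] have "tiling 3 3 5 5 1" by simp
  from tiling_add_block(3)[OF this, of 4] have "tiling 3 4 5 5 5" by simp
  then have "tiling 3 (3 * (n - t - 1) + 4) ((n - t - 1) * 4 + 5)
      ((n - t - 1) * 4 + 5) ((n - t - 1) * 4 + 5)"
    by (intro tiling_blocks_each) auto
  moreover have "3 * (n - t - 1) + 4 = t" "(n - t - 1) * 4 + 5 = n"
    using assms True by linarith+
  ultimately show ?thesis by simp
qed

text \<open>Stars have at most 4 vertices, so the two quintuples are independent: (6,6,6) is cut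
  into (5,0,0), (0,5,0), (1,0,3), (0,1,3), and the rest into independent quadruples.\<close>

lemma tiling_quadruples_quintuples:
  "tiling 4 (3 * k + 4) (4 * k + 6) (4 * k + 6) (4 * k + 6)"
proof -
  have "tiling 4 1 5 0 0" using tiling_add_block(1)[OF tiling.empty, of 5 4] by simp
  from tiling_add_block(2)[OF this, of 5] have "tiling 4 2 5 5 0" by (simp add: eval_nat_numeral)
  from tiling_add_star(2)[OF this, of 3] have "tiling 4 3 6 5 3" by simp
  from tiling_add_star(3)[OF this, of 3] have "tiling 4 4 6 6 6" by simp
  from tiling_blocks_each[OF this, of 4 k] show ?thesis by (simp add: mult.commute)
qed

section \<open>All numbers of colours, and the bound\<close>

lemma tiling_exists:
  assumes "n \<ge> 3" "3 * ((n + 1) div 4) \<le> t"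
  shows "\<exists>s. tiling s t n n n"
proof -
  define q where "q = (n + 1) div 4"
  have q: "q > 0" "4 * q \<le> n + 1" "n \<le> 4 * q + 2" "3 * q \<le> t"
    using assms by (auto simp: q_def)
  \<comment> \<open>Beyond \<open>t = 3 * q\<close>, the average size \<open>3 * n / t\<close>
    decides which \<open>s\<close> to use, from 4 down to 0.\<close>
  consider "t = 3 * q" | "t > 3 * q" "4 * t < 3 * n" | "3 * n \<le> 4 * t" "t \<le> n"
    | "n \<le> t" "2 * t \<le> 3 * n" | "3 * n < 2 * t" "t \<le> 3 * n" | "3 * n < t"
    using q(4) by linarith
  then show ?thesis
  proof cases
    case 1
    then show ?thesis using tiling_parts[OF q(1)] by blast
  next
    case 2
    \<comment> \<open>From \<open>12 * q + 4 \<le> 4 * t < 3 * n \<le> 12 * q + 6\<close> only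
      \<open>t = 3 * q + 1\<close> and \<open>n = 4 * q + 2\<close> remain.\<close>
    then have "t = 3 * (q - 1) + 4" "n = 4 * (q - 1) + 6" using q by linarith+
    then show ?thesis using tiling_quadruples_quintuples by metis
  next
    case 3
    then show ?thesis using tiling_triples_quadruples assms(1) by blast
  next
    case 4
    then show ?thesis using tiling_pairs_triples assms(1) by blast
  next
    case 5
    \<comment> \<open>The numbers of pairs and singletons solve \<open>x + y = t\<close> and
      \<open>2 * x + y = 3 * n\<close>.\<close>
    then have "tiling 1 ((3 * n - t) + (2 * t - 3 * n)) n n n"
      by (intro tiling_singles_pairs) simp
    then show ?thesis using 5 by auto
  next
    case 6
    then show ?thesis using tiling_singles_empties[of n "t - 3 * n"] by auto
  qed
qed

theorem theorem5:
  fixes n :: nat and G :: "('a,'b) pre_digraph"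
  assumes "n \<ge> 3"
    and "complete_tripartite_digraph n n n G"
  shows "strong_equitable_vertex_arboricity 3 G \<le> 3 * ((n + 1) div 4)"
proof -
  interpret graph G using assms(2) unfolding complete_tripartite_digraph_def by blast
  obtain U V W where UVW: "verts G = U \<union> V \<union> W"
      "U \<inter> V = {}" "U \<inter> W = {}" "V \<inter> W = {}"
      "card U = n" "card V = n" "card W = n"
    and ends: "arcs_ends G = U \<times> V \<union> V \<times> U \<union> U \<times> W \<union> W \<times> U \<union> V \<times> W \<union> W \<times> V"
    using assms(2) unfolding complete_tripartite_digraph_def by blast
  have "(tail G e, head G e) \<in> arcs_ends G" if "e \<in> arcs G" for e
    using that by (auto simp: arcs_ends_def arc_to_ends_def)
  then have indep: "independent_set G U" "independent_set G V" "independent_set G W"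
    using UVW(2-4) unfolding independent_set_def ends by blast+
  have fin: "finite U" "finite V" "finite W"
    using finite_verts unfolding UVW(1) by auto
  have "\<exists>f. equitable_tree_coloring G t 3 f" if t: "3 * ((n + 1) div 4) \<le> t" for t
  proof -
    obtain s where "tiling s t n n n" using tiling_exists[OF assms(1) t] by blast
    then have "star_partition G s t (verts G)"
      unfolding UVW(1) using UVW(2-7) fin indep by (intro star_partition_if_tiling) auto
    then show ?thesis by (rule equitable_tree_coloring_if_star_partition)
  qed
  then show ?thesis
    unfolding strong_equitable_vertex_arboricity_def by (intro Least_le) blast
qed

end
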